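(* Let $\mathbf{R}=\{r_1,\dots,r_n\}$ be a finite nonempty set of decision procedures, where $r_i$ has runtime $t_i$ and quality $q_i$, and let $c\ge 0$ be a fixed time cost. Let $r^*\in\arg\max_{r_i\in\mathbf{R}}(q_i-c\,t_i)$. Then the one-element sequence consisting of $r^*$ is a bounded optimal program for the episodic task environment with fixed time cost $c$; that is, $V(r^* )\ge V(s)$ for every agent program $s$ over $\mathbf{R}$, where $V$ is the fixed-time-cost value.
   Context: Each decision procedure (rule) $r_i\in\mathbf{R}$ has an integer runtime $t_i\ge 0$ and a real quality $q_i\ge 0$; it recommends an action, and $q_i$ is the expected utility of executing that action at the start of an episode. An agent program is a finite nonempty sequence $s=s_1\ldots s_m$ of elements of $\mathbf{R}$. Write $t_{s_i},q_{s_i}$ for the runtime and quality of $s_i$. Fixed time cost $c$: delaying an action by one time unit reduces its utility by $c$. There is no deadline; the architecture runs the entire sequence in order and then executes the action recommended by the highest-quality rule in it. Hence the value of the program is $V(s)=\max\{q_{s_1},\dots,q_{s_m}\}-c\sum_{i=1}^{m}t_{s_i}$. A program is bounded optimal if it maximizes $V$ among all agent programs over $\mathbf{R}$. *)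

theory Defs
  imports Complex_Main
begin

text \<open>
  Decision procedures are elements of an arbitrary type, with runtime \<open>t\<close> and quality \<open>q\<close>
  given as functions on it. Thus distinct procedures may share both runtime and quality, and
  a program may repeat a procedure.
\<close>

definition programs :: "'r set \<Rightarrow> 'r list set" where
  "programs R = {s. s \<noteq> [] \<and> set s \<subseteq> R}"

text \<open>
  There is no deadline: the whole sequence is run, and only then is the action recommended by
  a highest-quality rule in it executed. Every rule in the sequence, including each repetition,
  therefore contributes its runtime to the delay, which is charged at rate \<open>c\<close>.
  The \<open>Max\<close> is meaningful only for nonempty \<open>s\<close>.
\<close>

definition fixed_cost_value :: "('r \<Rightarrow> nat) \<Rightarrow> ('r \<Rightarrow> real) \<Rightarrow> real \<Rightarrow> 'r list \<Rightarrow> real" where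
  "fixed_cost_value t q c s = Max (q ` set s) - c * (\<Sum>r\<leftarrow>s. real (t r))"

definition bounded_optimal :: "'r set \<Rightarrow> ('r list \<Rightarrow> real) \<Rightarrow> 'r list \<Rightarrow> bool" where
  "bounded_optimal R V s \<longleftrightarrow> s \<in> programs R \<and> (\<forall>s'\<in>programs R. V s' \<le> V s)"

end

theory Submission
  imports Defs
begin

text \<open>A program earns the quality of only one of its rules but pays for the runtime of all of
  them. Cutting it down to a single rule of highest quality keeps the maximum and cannot raise the
  delay cost, so one-element programs dominate. Among these the value is
  \<open>q r - c * real (t r)\<close>, which \<open>r_star\<close> maximizes over
  \<open>R\<close>.\<close>

theorem theorem2:
  fixes R :: "'r set" and t :: "'r \<Rightarrow> nat" and q :: "'r \<Rightarrow> real" and c :: real and r_star :: 'r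
  assumes "finite R" and "R \<noteq> {}"
    and "\<And>r. r \<in> R \<Longrightarrow> 0 \<le> q r"
    and "0 \<le> c"
    and "is_arg_max (\<lambda>r. q r - c * real (t r)) (\<lambda>r. r \<in> R) r_star"
  shows "bounded_optimal R (fixed_cost_value t q c) [r_star]"
  unfolding bounded_optimal_def
proof (intro conjI ballI)
  have star: "r_star \<in> R" "\<And>r. r \<in> R \<Longrightarrow> q r - c * real (t r) \<le> q r_star - c * real (t r_star)"
    using assms(5) by (auto simp: is_arg_max_linorder)
  show "[r_star] \<in> programs R"
    using star(1) by (simp add: programs_def)
  fix s assume "s \<in> programs R"
  then have s: "s \<noteq> []" "set s \<subseteq> R" by (auto simp: programs_def)
  \<comment> \<open>The maximum over a finite nonempty set is attained; this supplies the rule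
    \<open>r\<close> to which \<open>s\<close> is cut down.\<close>
  have "Max (q ` set s) \<in> q ` set s"
    using s(1) by (intro Max_in) auto
  then obtain r where r: "r \<in> set s" "Max (q ` set s) = q r" by auto
  have "real (t r) \<le> (\<Sum>x\<leftarrow>s. real (t x))"
    using r(1) by (intro member_le_sum_list) auto
  then have "c * real (t r) \<le> c * (\<Sum>x\<leftarrow>s. real (t x))"
    using assms(4) by (rule mult_left_mono)
  \<comment> \<open>The right-hand side is the value of \<open>[r]\<close>, so the comparison is now
    between single rules.\<close>
  then have "fixed_cost_value t q c s \<le> q r - c * real (t r)"
    by (simp add: fixed_cost_value_def r(2))
  also have "\<dots> \<le> q r_star - c * real (t r_star)"
    using r(1) s(2) by (intro star(2)) auto
  finally show "fixed_cost_value t q c s \<le> fixed_cost_value t q c [r_star]"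
    by (simp add: fixed_cost_value_def)
qed

end
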